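(* Let $\mathcal D=\{D^1,\dots,D^m\}$ be a family of $m$ pairwise distinct distributions of value profiles $(v_1,\dots,v_n)$ of $n$ bidders, with a common finite support. If each $D^j$ satisfies the Crémer–McLean condition, and if the $m$ vectors $D^1,\dots,D^m$ span a linear space of dimension $d$, then with $k=m-d+1$ samples, for each bidder $i$ the vectors $\{F_i^{v_i,j}\}_{v_i\in T_i,\,j\in\{1,\dots,m\}}$ are linearly independent.
   Context: All distributions $D^j$ have the same finite support $T$; $T_i$ is the set of possible values $v_i$ of bidder $i$ and $T_{-i}$ the set of possible profiles $v_{-i}$ of the other bidders' values. Each $D^j$ is regarded as the vector $(D^j(v))_{v\in T}\in\mathbb R^{|T|}$ of its probabilities. For $v_i\in T_i$, $D^j_{i,v_i}\in\mathbb R^{|T_{-i}|}$ is the vector of conditional probabilities $(D^j(v_{-i}\mid v_i))_{v_{-i}}$. Crémer–McLean condition for $D$: for each bidder $i$, the $|T_i|$ vectors $\{D_{i,v_i}\}_{v_i\in T_i}$ are linearly independent. With $k$ samples, $F_i^{v_i,j}\in\mathbb R^{|T_{-i}|\times|T|^k}$ is the vector whose entry at $(v_{-i},s_1,\dots,s_k)$, $v_{-i}\in T_{-i}$, $s_1,\dots,s_k\in T$, is $$D^j(v_{-i}\mid v_i)\,D^j(s_1)\cdots D^j(s_k),$$ i.e. $F_i^{v_i,j}=D^j_{i,v_i}\otimes D^j\otimes\cdots\otimes D^j$ ($k$ Kronecker factors $D^j$): the probability, under $D^j$ and conditioned on bidder $i$'s value being $v_i$, that the others' values are $v_{-i}$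 and that $k$ independent samples from $D^j$ are $s_1,\dots,s_k$. Linear independence refers to the family indexed by pairs $(v_i,j)$. *)

theory Defs
  imports "HOL-Probability.Probability" "HOL-Library.Function_Algebras"
begin

text \<open>
  For a finite set \<open>X\<close>, the space of real vectors indexed by \<open>X\<close> is represented
  inside the real vector space \<open>'x \<Rightarrow> real\<close> of all functions, as the subspace of the
  functions that vanish outside \<open>X\<close>.
\<close>

definition fscale :: "real \<Rightarrow> ('x \<Rightarrow> real) \<Rightarrow> 'x \<Rightarrow> real" where
  "fscale c f = (\<lambda>x. c * f x)"

global_interpretation fun_vs: vector_space fscale
  by standard (auto simp: fscale_def fun_eq_iff algebra_simps)

definition vec_on :: "'x set \<Rightarrow> ('x \<Rightarrow> real) \<Rightarrow> 'x \<Rightarrow> real" where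
  "vec_on X f = (\<lambda>x. if x \<in> X then f x else 0)"

text \<open>
  Linear independence of an indexed family: repetitions count as dependence, which the
  library's set-based notion alone would not see.
\<close>

definition independent_family :: "('a \<Rightarrow> 'x \<Rightarrow> real) \<Rightarrow> 'a set \<Rightarrow> bool" where
  "independent_family F I \<longleftrightarrow> inj_on F I \<and> \<not> fun_vs.dependent (F ` I)"

lemma sum_fscale_eq_0_iff:
  "(\<Sum>a\<in>I. fscale (c a) (F a)) = 0 \<longleftrightarrow> (\<forall>x. (\<Sum>a\<in>I. c a * F a x) = 0)"
proof -
  have "(\<Sum>a\<in>I. fscale (c a) (F a)) x = (\<Sum>a\<in>I. c a * F a x)" for x
    by (induction I rule: infinite_finite_induct) (auto simp: fscale_def)
  then show ?thesis
    by (auto simp: fun_eq_iff)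
qed

lemma independent_family_iff:
  assumes "finite I"
  shows "independent_family F I \<longleftrightarrow>
    (\<forall>c. (\<forall>x. (\<Sum>a\<in>I. c a * F a x) = 0) \<longrightarrow> (\<forall>a\<in>I. c a = 0))"
proof
  assume L: "independent_family F I"
  show "\<forall>c. (\<forall>x. (\<Sum>a\<in>I. c a * F a x) = 0) \<longrightarrow> (\<forall>a\<in>I. c a = 0)"
  proof (intro allI impI ballI)
    fix c a assume z: "\<forall>x. (\<Sum>a\<in>I. c a * F a x) = 0" and a: "a \<in> I"
    have inj: "inj_on F I" and ind: "\<not> fun_vs.dependent (F ` I)"
      using L by (auto simp: independent_family_def)
    have "(\<Sum>f\<in>F ` I. fscale (c (the_inv_into I F f)) f) = (\<Sum>a\<in>I. fscale (c a) (F a))"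
      using inj by (simp add: sum.reindex the_inv_into_f_f)
    also have "\<dots> = 0"
      using z by (simp add: sum_fscale_eq_0_iff)
    finally have "c (the_inv_into I F (F a)) = 0"
      using fun_vs.independentD[OF ind, of "F ` I" "\<lambda>f. c (the_inv_into I F f)" "F a"] assms a
      by auto
    then show "c a = 0"
      using inj a by (simp add: the_inv_into_f_f)
  qed
next
  assume R: "\<forall>c. (\<forall>x. (\<Sum>a\<in>I. c a * F a x) = 0) \<longrightarrow> (\<forall>a\<in>I. c a = 0)"
  have inj: "inj_on F I"
  proof (rule inj_onI, rule ccontr)
    fix a b assume ab: "a \<in> I" "b \<in> I" "F a = F b" "a \<noteq> b"
    let ?c = "\<lambda>e. if e = a then 1 else if e = b then - 1 else (0::real)"
    have "(\<Sum>e\<in>I. ?c e * F e x) = 0" for x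
    proof -
      have "(\<Sum>e\<in>I. ?c e * F e x) = (\<Sum>e\<in>{a,b}. ?c e * F e x)"
        using assms ab by (intro sum.mono_neutral_right) auto
      then show ?thesis using ab by simp
    qed
    then show False using R[rule_format, of ?c a] ab by simp
  qed
  have "\<not> fun_vs.dependent (F ` I)"
  proof
    assume "fun_vs.dependent (F ` I)"
    then obtain u where u: "\<exists>f\<in>F ` I. u f \<noteq> 0" "(\<Sum>f\<in>F ` I. fscale (u f) f) = 0"
      using assms by (auto simp: fun_vs.dependent_finite)
    have "(\<Sum>a\<in>I. fscale (u (F a)) (F a)) = 0"
      using u(2) inj by (simp add: sum.reindex)
    then show False
      using R[rule_format, of "\<lambda>a. u (F a)"] u(1) by (auto simp: sum_fscale_eq_0_iff)
  qed
  with inj show "independent_family F I"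
    by (simp add: independent_family_def)
qed

text \<open>
  Bidders are the elements of a finite type \<open>'n\<close>; a value profile is a function
  \<open>'n \<Rightarrow> 'v\<close>. The profile of the values of the bidders other than \<open>i\<close> is the
  restriction of a profile to \<open>- {i}\<close>.
\<close>

definition others :: "'n \<Rightarrow> ('n \<Rightarrow> 'v) \<Rightarrow> 'n \<Rightarrow> 'v" where
  "others i v = restrict v (- {i})"

definition bidder_values :: "('n \<Rightarrow> 'v) set \<Rightarrow> 'n \<Rightarrow> 'v set" where
  "bidder_values T i = (\<lambda>v. v i) ` T"

definition others_profiles :: "('n \<Rightarrow> 'v) set \<Rightarrow> 'n \<Rightarrow> ('n \<Rightarrow> 'v) set" where
  "others_profiles T i = others i ` T"

definition cond_others :: "('n \<Rightarrow> 'v) pmf \<Rightarrow> 'n \<Rightarrow> 'v \<Rightarrow> ('n \<Rightarrow> 'v) \<Rightarrow> real" where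
  "cond_others P i x w =
    cond_prob (measure_pmf P) (\<lambda>v. others i v = w) (\<lambda>v. v i = x)"

definition dist_vec :: "('n \<Rightarrow> 'v) pmf \<Rightarrow> ('n \<Rightarrow> 'v) \<Rightarrow> real" where
  "dist_vec P = vec_on (set_pmf P) (pmf P)"

definition cond_vec :: "('n \<Rightarrow> 'v) pmf \<Rightarrow> 'n \<Rightarrow> 'v \<Rightarrow> ('n \<Rightarrow> 'v) \<Rightarrow> real" where
  "cond_vec P i x = vec_on (others_profiles (set_pmf P) i) (cond_others P i x)"

definition cremer_mclean :: "('n \<Rightarrow> 'v) pmf \<Rightarrow> bool" where
  "cremer_mclean P \<longleftrightarrow>
    (\<forall>i. independent_family (cond_vec P i) (bidder_values (set_pmf P) i))"

text \<open>The \<open>k\<close> samples are the entries of a list of length \<open>k\<close>.\<close>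

definition sample_vec ::
  "nat \<Rightarrow> ('n \<Rightarrow> 'v) pmf \<Rightarrow> 'n \<Rightarrow> 'v \<Rightarrow> ('n \<Rightarrow> 'v) \<times> ('n \<Rightarrow> 'v) list \<Rightarrow> real" where
  "sample_vec k P i x =
    vec_on (others_profiles (set_pmf P) i \<times> {s. set s \<subseteq> set_pmf P \<and> length s = k})
      (\<lambda>(w, s). cond_others P i x w * (\<Prod>l<k. pmf P (s ! l)))"

end

theory Submission imports Defs begin

text \<open>
  The entries of \<open>P j\<close> sum to one, so a relation among \<open>k + 1\<close>-fold tensor
  powers of the \<open>P j\<close> yields, by fixing one sample to be \<open>t\<close>, respectively by summing one
  sample out, relations among \<open>k\<close>-fold powers with coefficients \<open>c j * P j t\<close>,
  respectively \<open>c j\<close>. Their combination with coefficients \<open>c j * (P j t - P l t)\<close> does not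
  involve \<open>P l\<close>, and keeps \<open>P i\<close> if \<open>t\<close> separates \<open>P i\<close> from \<open>P l\<close>. Extend \<open>P i\<close> to a basis of
  the span consisting of \<open>d\<close> of the \<open>m\<close> distributions. Spending \<open>m - d\<close> samples to remove the
  others leaves a linear relation among basis vectors with the last sample, so the \<open>k\<close>-fold
  powers are independent for \<open>k = m - d + 1\<close>. For a fixed profile of the other bidders, a relation
  among the vectors of the theorem is a relation among these powers; it therefore splits into one
  relation for each \<open>j\<close>, to which the Cremer--McLean condition applies.
\<close>

lemma independent_familyD:
  assumes "independent_family F I" "finite I" "\<And>x. (\<Sum>a\<in>I. c a * F a x) = 0" "a \<in> I"
  shows "c a = 0"
  using assms(1,3,4) unfolding independent_family_iff[OF assms(2)] by simp

lemma dist_vec_eq_pmf: "dist_vec P = pmf P"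
  by (auto simp: dist_vec_def vec_on_def fun_eq_iff set_pmf_eq)

lemma prod_nth_eq_prod_list:
  fixes f :: "'a \<Rightarrow> 'b::comm_monoid_mult"
  assumes "length s = k"
  shows "(\<Prod>l<k. f (s ! l)) = prod_list (map f s)"
  using assms by (simp add: prod.list_conv_set_nth atLeast0LessThan)

text \<open>The vector \<open>c\<close> is a linear relation among the \<open>k\<close>-fold tensor
  powers of the \<open>pmf (P j)\<close>, tested entrywise. Samples form a list so that one tensor
  factor splits off as its head.\<close>

definition power_relation ::
  "('a \<Rightarrow> 'b pmf) \<Rightarrow> 'a set \<Rightarrow> 'b set \<Rightarrow> nat \<Rightarrow> ('a \<Rightarrow> real) \<Rightarrow> bool" where
  "power_relation P I T k c \<longleftrightarrow>
    (\<forall>s. set s \<subseteq> T \<and> length s = k \<longrightarrow> (\<Sum>j\<in>I. c j * prod_list (map (pmf (P j)) s)) = 0)"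

lemma power_relation_fix_sample:
  assumes "power_relation P I T (Suc k) c" "t \<in> T"
  shows "power_relation P I T k (\<lambda>j. c j * pmf (P j) t)"
  unfolding power_relation_def
proof (intro allI impI)
  fix s assume "set s \<subseteq> T \<and> length s = k"
  then have "(\<Sum>j\<in>I. c j * prod_list (map (pmf (P j)) (t # s))) = 0"
    using assms unfolding power_relation_def by (metis insert_subset length_Cons list.simps(15))
  then show "(\<Sum>j\<in>I. c j * pmf (P j) t * prod_list (map (pmf (P j)) s)) = 0"
    by (simp add: mult.assoc)
qed

lemma power_relation_sum_out:
  assumes "finite T" and supp: "\<And>j. j \<in> I \<Longrightarrow> set_pmf (P j) \<subseteq> T"
    and "power_relation P I T (Suc k) c"
  shows "power_relation P I T k c"
  unfolding power_relation_def
proof (intro allI impI)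
  fix s assume s: "set s \<subseteq> T \<and> length s = k"
  \<comment> \<open>The total mass 1 of \<open>P j\<close> on \<open>T\<close> is inserted as a
    factor; its summation variable becomes the extra sample.\<close>
  have "(\<Sum>j\<in>I. c j * prod_list (map (pmf (P j)) s))
      = (\<Sum>j\<in>I. (\<Sum>t\<in>T. pmf (P j) t) * (c j * prod_list (map (pmf (P j)) s)))"
    using assms(1) supp by (intro sum.cong) (simp_all add: sum_pmf_eq_1)
  also have "\<dots> = (\<Sum>t\<in>T. \<Sum>j\<in>I. c j * pmf (P j) t * prod_list (map (pmf (P j)) s))"
    by (subst sum.swap) (simp add: sum_distrib_left sum_distrib_right mult_ac)
  also have "\<dots> = 0"
    using power_relation_fix_sample[OF assms(3)] s
    by (intro sum.neutral) (auto simp: power_relation_def)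
  finally show "(\<Sum>j\<in>I. c j * prod_list (map (pmf (P j)) s)) = 0" .
qed

text \<open>Each index in \<open>J\<close> costs one sample. The multiplier \<open>b j\<close> is a
  product of factors \<open>pmf (P j) t - pmf (P l) t\<close>, one for each \<open>l\<close> in
  \<open>J\<close>, where \<open>t\<close> separates \<open>P i\<close> from
  \<open>P l\<close>.\<close>

lemma power_relation_eliminate:
  assumes "finite T" and supp: "\<And>j. j \<in> I \<Longrightarrow> set_pmf (P j) \<subseteq> T"
    and inj: "inj_on P I" and i: "i \<in> I"
    and "finite J" "J \<subseteq> I - {i}"
    and "power_relation P I T (card J + r) c"
  shows "\<exists>b. b i \<noteq> 0 \<and> (\<forall>j\<in>J. b j = 0) \<and> power_relation P I T r (\<lambda>j. c j * b j)"
  using assms(5-7)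
proof (induction J arbitrary: c rule: finite_induct)
  case empty
  then show ?case by (intro exI[of _ "\<lambda>_. 1"]) simp
next
  case (insert l J)
  have "P i \<noteq> P l"
    using inj i insert.prems(1) by (auto simp: inj_on_def)
  then obtain t where t: "pmf (P i) t \<noteq> pmf (P l) t"
    by (metis pmf_eqI)
  \<comment> \<open>Both masses vanish off \<open>T\<close>, so a separating point lies in
    \<open>T\<close> and may be used as a sample.\<close>
  then have "t \<in> T"
    using supp i insert.prems(1) by (metis DiffD1 insert_subset pmf_eq_0_set_pmf subsetD)
  have rel: "power_relation P I T (Suc (card J + r)) c"
    using insert.prems(2) insert.hyps by simp
  \<comment> \<open>This factor is zero at \<open>l\<close> and nonzero at \<open>i\<close>.\<close>
  define a where "a j = pmf (P j) t - pmf (P l) t" for j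
  have "power_relation P I T (card J + r) (\<lambda>j. c j * a j)"
    unfolding power_relation_def
  proof (intro allI impI)
    fix s assume s: "set s \<subseteq> T \<and> length s = card J + r"
    have "(\<Sum>j\<in>I. c j * pmf (P j) t * prod_list (map (pmf (P j)) s)) = 0"
      "(\<Sum>j\<in>I. c j * prod_list (map (pmf (P j)) s)) = 0"
      using power_relation_fix_sample[OF rel \<open>t \<in> T\<close>]
        power_relation_sum_out[OF assms(1) supp rel] s
      by (auto simp: power_relation_def)
    moreover have "(\<Sum>j\<in>I. c j * a j * prod_list (map (pmf (P j)) s))
        = (\<Sum>j\<in>I. c j * pmf (P j) t * prod_list (map (pmf (P j)) s))
          - pmf (P l) t * (\<Sum>j\<in>I. c j * prod_list (map (pmf (P j)) s))"
      by (simp add: a_def sum_distrib_left sum_subtractf[symmetric] algebra_simps)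
    ultimately show "(\<Sum>j\<in>I. c j * a j * prod_list (map (pmf (P j)) s)) = 0"
      by simp
  qed
  then obtain b where b: "b i \<noteq> 0" "\<forall>j\<in>J. b j = 0"
    "power_relation P I T r (\<lambda>j. c j * a j * b j)"
    using insert.IH insert.prems(1) by blast
  show ?case
    using b t by (intro exI[of _ "\<lambda>j. a j * b j"]) (auto simp: a_def mult.assoc)
qed

text \<open>The basis used depends on \<open>i\<close>, hence coefficients are shown to vanish one
  at a time.\<close>

lemma power_relation_trivial:
  assumes "finite T" and supp: "\<And>j. j \<in> I \<Longrightarrow> set_pmf (P j) \<subseteq> T"
    and "finite I" and inj: "inj_on P I"
    and rel: "power_relation P I T (card I - fun_vs.dim ((\<lambda>j. pmf (P j)) ` I) + 1) c"
    and i: "i \<in> I"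
  shows "c i = 0"
proof -
  let ?p = "\<lambda>j. pmf (P j)"
  have injp: "inj_on ?p I"
    using inj by (metis (mono_tags, lifting) inj_on_def pmf_eqI)
  have "?p i \<noteq> 0"
    using set_pmf_not_empty[of "P i"] by (auto simp: set_pmf_eq)
  then have "fun_vs.independent {?p i}"
    by simp
  \<comment> \<open>Starting the basis from \<open>?p i\<close> keeps \<open>i\<close> out of the
    indices to be eliminated.\<close>
  then obtain B where B: "{?p i} \<subseteq> B" "B \<subseteq> ?p ` I" "fun_vs.independent B" "?p ` I \<subseteq> fun_vs.span B"
    using fun_vs.maximal_independent_subset_extend[of "{?p i}" "?p ` I"] i by blast
  define K where "K = {j \<in> I. ?p j \<in> B}"
  have K: "K \<subseteq> I" "i \<in> K" "finite K" "?p ` K = B" "inj_on ?p K"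
    using B i \<open>finite I\<close> inj_on_subset[OF injp, of K] by (auto simp: K_def)
  have "card K = fun_vs.dim (?p ` I)"
    using fun_vs.dim_unique[OF B(2,4,3) refl] K by (metis card_image)
  then have "card (I - K) = card I - fun_vs.dim (?p ` I)"
    using K by (simp add: card_Diff_subset)
  then have "power_relation P I T (card (I - K) + 1) c"
    using rel by simp
  then obtain b where b: "b i \<noteq> 0" "\<forall>j\<in>I - K. b j = 0" "power_relation P I T 1 (\<lambda>j. c j * b j)"
    using power_relation_eliminate[OF assms(1) supp inj i, of "I - K" 1 c] K \<open>finite I\<close> by auto
  \<comment> \<open>The one remaining sample gives the relation on \<open>T\<close>; elsewhere every
    mass is zero.\<close>
  have "(\<Sum>j\<in>K. c j * b j * ?p j t) = 0" for t
  proof (cases "t \<in> T")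
    case True
    then have "(\<Sum>j\<in>I. c j * b j * prod_list (map (?p j) [t])) = 0"
      using b(3) unfolding power_relation_def by (metis One_nat_def empty_set empty_subsetI
          insert_subset length_Cons list.simps(15) list.size(3))
    moreover have "(\<Sum>j\<in>K. c j * b j * ?p j t) = (\<Sum>j\<in>I. c j * b j * ?p j t)"
      using K \<open>finite I\<close> b(2) by (intro sum.mono_neutral_left) auto
    ultimately show ?thesis by simp
  next
    case False
    then show ?thesis
      using supp K by (intro sum.neutral) (auto simp: set_pmf_eq)
  qed
  moreover have "independent_family ?p K"
    using B(3) K by (simp add: independent_family_def)
  ultimately have "c i * b i = 0"
    using independent_familyD[of ?p K "\<lambda>j. c j * b j"] K(2,3) by blast
  then show ?thesis
    using b(1) by simp
qed

theorem theorem8: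
  fixes D :: "nat \<Rightarrow> ('n::finite \<Rightarrow> 'v) pmf"
    and T :: "('n \<Rightarrow> 'v) set"
    and m d k :: nat
  assumes "finite T"
    and "\<And>j. j \<in> {1..m} \<Longrightarrow> set_pmf (D j) = T"
    and "inj_on D {1..m}"
    and "\<And>j. j \<in> {1..m} \<Longrightarrow> cremer_mclean (D j)"
    and "fun_vs.dim (fun_vs.span ((\<lambda>j. dist_vec (D j)) ` {1..m})) = d"
    and "k = m - d + 1"
  shows "\<forall>i. independent_family (\<lambda>(x, j). sample_vec k (D j) i x)
               (bidder_values T i \<times> {1..m})"
proof
  fix i
  let ?V = "bidder_values T i" and ?I = "{1..m}" and ?W = "others_profiles T i"
  have fin: "finite ?V"
    using assms(1) by (simp add: bidder_values_def)
  have dim: "d = fun_vs.dim ((\<lambda>j. pmf (D j)) ` ?I)"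
    using assms(5) by (simp add: dist_vec_eq_pmf)
  show "independent_family (\<lambda>(x, j). sample_vec k (D j) i x) (?V \<times> ?I)"
  proof (subst independent_family_iff, use fin in simp, intro allI impI ballI)
    fix c a
    assume z: "\<forall>y. (\<Sum>a\<in>?V \<times> ?I. c a * (case a of (x, j) \<Rightarrow> sample_vec k (D j) i x) y) = 0"
      and a: "a \<in> ?V \<times> ?I"
    obtain x0 j0 where a_eq: "a = (x0, j0)" and x0: "x0 \<in> ?V" and j0: "j0 \<in> ?I"
      using a by auto
    have "(\<Sum>x\<in>?V. c (x, j0) * cond_vec (D j0) i x w) = 0" for w
    proof (cases "w \<in> ?W")
      case True
      \<comment> \<open>With \<open>w\<close> fixed, summing over \<open>x\<close> first leaves a
        single coefficient for each \<open>j\<close>.\<close>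
      have "power_relation D ?I T (card ?I - fun_vs.dim ((\<lambda>j. pmf (D j)) ` ?I) + 1)
          (\<lambda>j. \<Sum>x\<in>?V. c (x, j) * cond_others (D j) i x w)"
        unfolding power_relation_def
      proof (intro allI impI)
        fix s
        assume "set s \<subseteq> T \<and> length s = card ?I - fun_vs.dim ((\<lambda>j. pmf (D j)) ` ?I) + 1"
        then have s: "set s \<subseteq> T" "length s = k"
          using assms(6) dim by auto
        have "(\<Sum>j\<in>?I. (\<Sum>x\<in>?V. c (x, j) * cond_others (D j) i x w)
              * prod_list (map (pmf (D j)) s))
            = (\<Sum>j\<in>?I. \<Sum>x\<in>?V. c (x, j) * sample_vec k (D j) i x (w, s))"
          using True s assms(2)
          by (auto intro!: sum.cong
              simp: sum_distrib_right sample_vec_def vec_on_def prod_nth_eq_prod_list mult.assoc)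
        also have "\<dots> = (\<Sum>a\<in>?V \<times> ?I. c a * (case a of (x, j) \<Rightarrow> sample_vec k (D j) i x) (w, s))"
          by (subst sum.swap) (simp add: sum.cartesian_product case_prod_unfold)
        finally show "(\<Sum>j\<in>?I. (\<Sum>x\<in>?V. c (x, j) * cond_others (D j) i x w)
              * prod_list (map (pmf (D j)) s)) = 0"
          using z by simp
      qed
      then have "(\<Sum>x\<in>?V. c (x, j0) * cond_others (D j0) i x w) = 0"
        using power_relation_trivial[OF assms(1) _ _ assms(3) _ j0] assms(2) by simp
      then show ?thesis
        using True assms(2)[OF j0] by (simp add: cond_vec_def vec_on_def)
    next
      case False
      then show ?thesis
        using assms(2)[OF j0] by (simp add: cond_vec_def vec_on_def)
    qed
    moreover have "independent_family (cond_vec (D j0) i) ?V"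
      using assms(4)[OF j0] assms(2)[OF j0] by (auto simp: cremer_mclean_def)
    ultimately show "c a = 0"
      using independent_familyD[of "cond_vec (D j0) i" ?V "\<lambda>x. c (x, j0)"] fin x0 a_eq by blast
  qed
qed

end
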